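(* Let $\mathcal{X}$ be a real Hilbert space, and let $\delta>0$, $\mu\ge0$ and $\nu\ge0$. Suppose that $g:[\delta,+\infty)\to\mathcal{X}$ and $a:[\delta,+\infty)\to(-\infty,0]$ are two continuously differentiable functions. If there exist constants $C_0\in(-1,0)$ and $\widehat{C}\ge0$ such that $$e^{-\mu t^{\nu}}\int_{\delta}^{t}a(\tau)\,d\tau\ge C_0,\qquad\forall t\ge\delta,$$ and $$\left\|g(t)+e^{-\mu t^{\nu}}\int_{\delta}^{t}a(\tau)g(\tau)\,d\tau\right\|\le\widehat{C},\qquad\forall t\ge\delta,$$ then $$\sup_{t\ge\delta}\|g(t)\|<+\infty.$$ *)

theory Defs
  imports "HOL-Analysis.Analysis"
begin

text \<open>
  The derivative is taken within \<open>S\<close>, hence one-sided at an endpoint of a closed interval. The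
  library predicate \<open>C1_differentiable_on\<close> uses two-sided derivatives instead, which would constrain
  the values of \<open>f\<close> outside \<open>S\<close>.
\<close>

definition continuously_differentiable_on ::
    "(real \<Rightarrow> 'a::real_normed_vector) \<Rightarrow> real set \<Rightarrow> bool" where
  "continuously_differentiable_on f S \<longleftrightarrow>
     (\<exists>f'. (\<forall>t\<in>S. (f has_vector_derivative f' t) (at t within S)) \<and> continuous_on S f')"

end

theory Submission
  imports Defs
begin

text \<open>
  On a compact interval \<open>{\<delta>..T}\<close> the norm of \<open>g\<close> attains its maximum \<open>M\<close>, at \<open>s\<close> say. Since
  \<open>a \<le> 0\<close>, the integral term at \<open>s\<close> has norm at most \<open>-C\<^sub>0 * M\<close>, whence \<open>M \<le> C_hat + (-C\<^sub>0) * M\<close>.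
  As \<open>-C\<^sub>0 < 1\<close>, this bounds \<open>M\<close> by \<open>C_hat / (1 + C\<^sub>0)\<close>, independently of \<open>T\<close>.
\<close>

lemma continuously_differentiable_on_imp_continuous_on:
  assumes "continuously_differentiable_on f S"
  shows "continuous_on S f"
  using assms
  by (auto simp: continuously_differentiable_on_def continuous_on_eq_continuous_within
      intro: has_vector_derivative_continuous)

text \<open>The exponential factor enters the argument only through its sign and the lower bound
  \<open>C\<close>, so it is abstracted to a nonnegative weight \<open>w\<close>.\<close>

lemma norm_le_if_integral_perturbation_bounded:
  fixes g :: "real \<Rightarrow> 'a::banach" and a w :: "real \<Rightarrow> real"
  assumes g: "continuous_on {\<delta>..} g" and a: "continuous_on {\<delta>..} a"
    and a_nonpos: "\<And>t. t \<ge> \<delta> \<Longrightarrow> a t \<le> 0"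
    and w_nonneg: "\<And>t. t \<ge> \<delta> \<Longrightarrow> w t \<ge> 0"
    and C: "-1 < C" "\<And>t. t \<ge> \<delta> \<Longrightarrow> w t * integral {\<delta>..t} a \<ge> C"
    and B: "\<And>t. t \<ge> \<delta> \<Longrightarrow> norm (g t + w t *\<^sub>R integral {\<delta>..t} (\<lambda>\<tau>. a \<tau> *\<^sub>R g \<tau>)) \<le> B"
    and T: "T \<ge> \<delta>"
  shows "norm (g T) \<le> B / (1 + C)"
proof -
  have "continuous_on {\<delta>..T} (\<lambda>t. norm (g t))"
    by (intro continuous_on_norm continuous_on_subset[OF g]) auto
  then obtain s where s: "s \<in> {\<delta>..T}" and max: "\<And>t. t \<in> {\<delta>..T} \<Longrightarrow> norm (g t) \<le> norm (g s)"
    using continuous_attains_sup[of "{\<delta>..T}" "\<lambda>t. norm (g t)"] T by auto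
  let ?M = "norm (g s)" and ?I = "integral {\<delta>..s} (\<lambda>\<tau>. a \<tau> *\<^sub>R g \<tau>)"
  have gs: "continuous_on {\<delta>..s} g" and as: "continuous_on {\<delta>..s} a"
    by (auto intro: continuous_on_subset[OF g] continuous_on_subset[OF a])
  \<comment> \<open>Since \<open>s\<close> lies in \<open>{\<delta>..T}\<close>, the maximum
    \<open>?M\<close> also dominates \<open>norm (g \<tau>)\<close> on \<open>{\<delta>..s}\<close>.
    The sign of \<open>a\<close> turns its absolute value into \<open>- a\<close>, so the bound
    involves the very integral that \<open>C\<close> controls.\<close>
  have "norm ?I \<le> integral {\<delta>..s} (\<lambda>\<tau>. - a \<tau> * ?M)"
  proof (rule integral_norm_bound_integral)
    show "(\<lambda>\<tau>. a \<tau> *\<^sub>R g \<tau>) integrable_on {\<delta>..s}" "(\<lambda>\<tau>. - a \<tau> * ?M) integrable_on {\<delta>..s}"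
      by (intro integrable_continuous_real continuous_intros as gs)+
    show "norm (a \<tau> *\<^sub>R g \<tau>) \<le> - a \<tau> * ?M" if "\<tau> \<in> {\<delta>..s}" for \<tau>
      using that a_nonpos[of \<tau>] max[of \<tau>] s by (auto simp: abs_of_nonpos intro!: mult_left_mono_neg)
  qed
  also have "\<dots> = - integral {\<delta>..s} a * ?M"
    by simp
  finally have I_le: "norm ?I \<le> - integral {\<delta>..s} a * ?M" .
  have "norm (w s *\<^sub>R ?I) = w s * norm ?I"
    using w_nonneg[of s] s by simp
  also have "\<dots> \<le> w s * (- integral {\<delta>..s} a * ?M)"
    using w_nonneg[of s] s by (intro mult_left_mono I_le) auto
  also have "\<dots> = - (w s * integral {\<delta>..s} a) * ?M"
    by simp
  also have "\<dots> \<le> - C * ?M"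
    using C(2)[of s] s by (intro mult_right_mono) auto
  \<comment> \<open>Here \<open>g s\<close> is recovered as the perturbed sum minus the integral
    term, whose norm was just bounded by \<open>- C * ?M\<close>.\<close>
  finally have "?M \<le> B - C * ?M"
    using B[of s] s norm_triangle_ineq4[of "g s + w s *\<^sub>R ?I" "w s *\<^sub>R ?I"] by simp
  then have "?M \<le> B / (1 + C)"
    using C(1) by (simp add: field_simps)
  then show ?thesis
    using max[of T] T by simp
qed

theorem lemma2p4:
  fixes g :: "real \<Rightarrow> 'x::{real_inner, banach}"
    and a :: "real \<Rightarrow> real"
    and \<delta> \<mu> \<nu> C\<^sub>0 C_hat :: real
  assumes "\<delta> > 0" and "\<mu> \<ge> 0" and "\<nu> \<ge> 0"
    and "continuously_differentiable_on g {\<delta>..}"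
    and "continuously_differentiable_on a {\<delta>..}"
    and "\<forall>t\<ge>\<delta>. a t \<le> 0"
    and "-1 < C\<^sub>0" and "C\<^sub>0 < 0" and "C_hat \<ge> 0"
    and "\<forall>t\<ge>\<delta>. exp (- \<mu> * t powr \<nu>) * integral {\<delta>..t} a \<ge> C\<^sub>0"
    and "\<forall>t\<ge>\<delta>. norm (g t + exp (- \<mu> * t powr \<nu>) *\<^sub>R integral {\<delta>..t} (\<lambda>\<tau>. a \<tau> *\<^sub>R g \<tau>)) \<le> C_hat"
  shows "(SUP t\<in>{\<delta>..}. ereal (norm (g t))) < \<infinity>"
proof -
  have "norm (g t) \<le> C_hat / (1 + C\<^sub>0)" if "t \<ge> \<delta>" for t
    using assms that
    by (intro norm_le_if_integral_perturbation_bounded[where \<delta> = \<delta> and a = a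
          and w = "\<lambda>t. exp (- \<mu> * t powr \<nu>)"])
      (auto intro: continuously_differentiable_on_imp_continuous_on)
  \<comment> \<open>In the complete lattice \<open>ereal\<close> a uniform pointwise bound passes to
    the supremum without side conditions, and a real bound makes it finite.\<close>
  then have "(SUP t\<in>{\<delta>..}. ereal (norm (g t))) \<le> ereal (C_hat / (1 + C\<^sub>0))"
    by (intro SUP_least) auto
  then show ?thesis
    by (rule order.strict_trans1) simp
qed

end
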